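(* Let $\mathcal H$ be a complex Hilbert space and let $\mathcal A\subseteq\mathcal B(\mathcal H)$ be a unital $\sigma$-weakly closed algebra which is $\sigma$-weakly generated by the rank-one operators in $\mathcal A$. Then for every $\sigma$-weakly closed right $\mathcal A$-submodule $\mathcal U$ of $\mathcal B(\mathcal H)$ there exists $\phi\in\mathrm{Hom}(\mathrm{Lat}\,\mathcal A,\mathcal P)$ such that $\mathcal U=\{T\in\mathcal B(\mathcal H): TE\subseteq\phi(E)\ \text{for all } E\in\mathrm{Lat}\,\mathcal A\}$, and for every $\sigma$-weakly closed left $\mathcal A$-submodule $\mathcal U$ of $\mathcal B(\mathcal H)$ there exists $\psi\in\mathrm{Hom}(\mathrm{Lat}\,\mathcal A,\mathcal P)$ such that $\mathcal U=\{T\in\mathcal B(\mathcal H): T\psi(E)\subseteq E\ \text{for all } E\in\mathrm{Lat}\,\mathcal A\}$.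
   Context: $\mathcal B(\mathcal H)$ is the algebra of bounded linear operators on $\mathcal H$, and $\mathcal P$ is the complete lattice of all orthogonal projections in $\mathcal B(\mathcal H)$. Projections are identified with their ranges; $TE\subseteq F$ means that $T$ maps the range of $E$ into the range of $F$. Unital means containing the identity $I$. "$\sigma$-weakly generated by the rank-one operators in $\mathcal A$" means that $\mathcal A$ is the $\sigma$-weak closure of the linear span of the rank-one operators belonging to $\mathcal A$. $\mathrm{Lat}\,\mathcal A$ is the complete lattice of projections invariant under every element of $\mathcal A$. $\mathrm{Hom}(\mathrm{Lat}\,\mathcal A,\mathcal P)$ is the set of order homomorphisms (maps $\phi$ with $E\le F\Rightarrow\phi(E)\le\phi(F)$) from $\mathrm{Lat}\,\mathcal A$ into $\mathcal P$. A right (left) $\mathcal A$-submodule is a linear subspace $\mathcal U\subseteq\mathcal B(\mathcal H)$ with $\mathcal U\mathcal A\subseteq\mathcal U$ ($\mathcal A\,\mathcal U\subseteq\mathcal U$). *)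

theory Defs
  imports "HOL-Analysis.Analysis"
begin

section \<open>Complex Hilbert spaces\<close>

class scaleC =
  fixes scaleC :: "complex \<Rightarrow> 'a \<Rightarrow> 'a"  (infixr \<open>*\<^sub>C\<close> 75)

class complex_vector = real_vector + scaleC +
  assumes scaleC_add_right: "a *\<^sub>C (x + y) = a *\<^sub>C x + a *\<^sub>C y"
    and scaleC_add_left: "(a + b) *\<^sub>C x = a *\<^sub>C x + b *\<^sub>C x"
    and scaleC_scaleC: "a *\<^sub>C b *\<^sub>C x = (a * b) *\<^sub>C x"
    and scaleR_scaleC: "r *\<^sub>R x = complex_of_real r *\<^sub>C x"

text \<open>
  The real structure required by the library classes is the one underlying the
  complex structure: \<open>real_inner\<close> is the real part of the (first-argument linear)
  complex inner product, so that the norm is the usual Hilbert space norm and positive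
  definiteness is inherited from \<open>real_inner\<close>.
\<close>

class complex_hilbert = complex_vector + real_inner + complete_space +
  fixes cinner :: "'a \<Rightarrow> 'a \<Rightarrow> complex"
  assumes cinner_commute: "cinner x y = cnj (cinner y x)"
    and cinner_add_left: "cinner (x + y) z = cinner x z + cinner y z"
    and cinner_scaleC_left: "cinner (c *\<^sub>C x) y = c * cinner x y"
    and inner_eq_Re_cinner: "inner x y = Re (cinner x y)"

instantiation complex :: complex_hilbert
begin
definition scaleC_complex :: "complex \<Rightarrow> complex \<Rightarrow> complex"
  where "scaleC_complex c x = c * x"
definition cinner_complex :: "complex \<Rightarrow> complex \<Rightarrow> complex"
  where "cinner_complex x y = x * cnj y"
instance
  by standard
    (auto simp: scaleC_complex_def cinner_complex_def inner_complex_def algebra_simps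
      scaleR_conv_of_real)
end

global_interpretation complex_vector:
  vector_space "scaleC :: complex \<Rightarrow> 'a \<Rightarrow> 'a::complex_vector"
proof
  fix x :: 'a
  show "1 *\<^sub>C x = x"
    using scaleR_scaleC[of 1 x] by simp
qed (simp_all add: scaleC_add_right scaleC_add_left scaleC_scaleC)

lemma cinner_self: "cinner x x = complex_of_real ((norm (x::'a::complex_hilbert))\<^sup>2)"
proof (rule complex_eqI)
  show "Re (cinner x x) = Re (complex_of_real ((norm x)\<^sup>2))"
    by (simp add: power2_norm_eq_inner inner_eq_Re_cinner)
  show "Im (cinner x x) = Im (complex_of_real ((norm x)\<^sup>2))"
    using arg_cong[OF cinner_commute[of x x], of Im] by simp
qed

lemma norm_scaleC: "norm (c *\<^sub>C x) = cmod c * norm (x::'a::complex_hilbert)"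
proof -
  have "cinner (c *\<^sub>C x) (c *\<^sub>C x) = c * (cnj c * cinner x x)"
    by (metis cinner_commute cinner_scaleC_left complex_cnj_mult)
  also have "\<dots> = complex_of_real ((cmod c * norm x)\<^sup>2)"
    by (simp add: cinner_self power_mult_distrib complex_norm_square[symmetric]
        mult.assoc[symmetric] del: of_real_power)
  finally have "(norm (c *\<^sub>C x))\<^sup>2 = (cmod c * norm x)\<^sup>2"
    unfolding cinner_self of_real_eq_iff .
  then show ?thesis
    by (rule power2_eq_imp_eq) auto
qed

section \<open>Bounded operators\<close>

text \<open>
  The library type of bounded linear maps consists of real-linear maps. Into a complex
  space these form a complex vector space, in which the complex-linear ones are a
  subspace.
\<close>

instantiation blinfun :: (real_normed_vector, complex_hilbert) complex_vector
begin
lift_definition scaleC_blinfun :: "complex \<Rightarrow> ('a \<Rightarrow>\<^sub>L 'b) \<Rightarrow> 'a \<Rightarrow>\<^sub>L 'b"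
  is "\<lambda>c f x. c *\<^sub>C f x"
proof -
  fix c :: complex and f :: "'a \<Rightarrow> 'b"
  assume "bounded_linear f"
  then interpret f: bounded_linear f .
  show "bounded_linear (\<lambda>x. c *\<^sub>C f x)"
  proof (rule bounded_linear_intro)
    fix x y and r :: real
    show "c *\<^sub>C f (x + y) = c *\<^sub>C f x + c *\<^sub>C f y"
      by (simp add: f.add scaleC_add_right)
    show "c *\<^sub>C f (r *\<^sub>R x) = r *\<^sub>R (c *\<^sub>C f x)"
      by (simp add: f.scaleR scaleR_scaleC scaleC_scaleC mult.commute)
    show "norm (c *\<^sub>C f x) \<le> norm x * (cmod c * onorm f)"
      using mult_left_mono[OF onorm[OF \<open>bounded_linear f\<close>, of x], of "cmod c"]
      by (simp add: norm_scaleC mult_ac)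
  qed
qed
instance
  by standard
    (transfer, simp add: scaleC_add_right scaleC_add_left scaleC_scaleC scaleR_scaleC)+
end

definition bounded_ops :: "('a::complex_hilbert \<Rightarrow>\<^sub>L 'a) set"
  where "bounded_ops = {T. \<forall>c x. blinfun_apply T (c *\<^sub>C x) = c *\<^sub>C blinfun_apply T x}"

definition rank_one :: "('a::complex_hilbert \<Rightarrow>\<^sub>L 'a) \<Rightarrow> bool"
  where "rank_one T \<longleftrightarrow> T \<in> bounded_ops \<and> complex_vector.dim (range (blinfun_apply T)) = 1"

section \<open>The sigma-weak topology\<close>

definition sq_summable :: "(nat \<Rightarrow> 'a::real_normed_vector) \<Rightarrow> bool"
  where "sq_summable x \<longleftrightarrow> summable (\<lambda>n. (norm (x n))\<^sup>2)"

definition sigma_weak_functional ::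
    "(nat \<Rightarrow> 'a::complex_hilbert) \<Rightarrow> (nat \<Rightarrow> 'a) \<Rightarrow> ('a \<Rightarrow>\<^sub>L 'a) \<Rightarrow> complex"
  where "sigma_weak_functional x y T = (\<Sum>n. cinner (blinfun_apply T (x n)) (y n))"

text \<open>The coarsest topology on the bounded operators making all these functionals continuous.\<close>

definition sigma_weak :: "('a::complex_hilbert \<Rightarrow>\<^sub>L 'a) topology"
  where "sigma_weak = topology_generated_by
    {{T \<in> bounded_ops. sigma_weak_functional x y T \<in> V} | x y V.
      sq_summable x \<and> sq_summable y \<and> open V}"

lemma topspace_sigma_weak: "topspace sigma_weak = bounded_ops"
proof -
  have "sq_summable (\<lambda>n. 0 :: 'a)"
    by (simp add: sq_summable_def)
  then have "(bounded_ops :: ('a \<Rightarrow>\<^sub>L 'a) set) \<in>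
      {{T \<in> bounded_ops. sigma_weak_functional x y T \<in> V} | x y V.
        sq_summable x \<and> sq_summable y \<and> open V}"
    by (intro CollectI exI[of _ "\<lambda>n. 0"] exI[of _ UNIV]) auto
  then show ?thesis
    unfolding sigma_weak_def topology_generated_by_topspace by blast
qed

section \<open>Projections, invariant projections and order homomorphisms\<close>

definition projections :: "('a::complex_hilbert \<Rightarrow>\<^sub>L 'a) set"
  where "projections = {E \<in> bounded_ops. E o\<^sub>L E = E \<and>
    (\<forall>x y. cinner (blinfun_apply E x) y = cinner x (blinfun_apply E y))}"

definition maps_into ::
    "('a::complex_hilbert \<Rightarrow>\<^sub>L 'a) \<Rightarrow> ('a \<Rightarrow>\<^sub>L 'a) \<Rightarrow> ('a \<Rightarrow>\<^sub>L 'a) \<Rightarrow> bool"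
  where "maps_into T E F \<longleftrightarrow>
    blinfun_apply T ` range (blinfun_apply E) \<subseteq> range (blinfun_apply F)"

definition proj_le :: "('a::complex_hilbert \<Rightarrow>\<^sub>L 'a) \<Rightarrow> ('a \<Rightarrow>\<^sub>L 'a) \<Rightarrow> bool"
  where "proj_le E F \<longleftrightarrow> range (blinfun_apply E) \<subseteq> range (blinfun_apply F)"

definition Lat :: "('a::complex_hilbert \<Rightarrow>\<^sub>L 'a) set \<Rightarrow> ('a \<Rightarrow>\<^sub>L 'a) set"
  where "Lat \<A> = {E \<in> projections. \<forall>T\<in>\<A>. maps_into T E E}"

text \<open>Only the values of a homomorphism on its domain are constrained.\<close>

definition order_hom ::
    "('a::complex_hilbert \<Rightarrow>\<^sub>L 'a) set \<Rightarrow> ('a \<Rightarrow>\<^sub>L 'a) set \<Rightarrow>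
     (('a \<Rightarrow>\<^sub>L 'a) \<Rightarrow> ('a \<Rightarrow>\<^sub>L 'a)) set"
  where "order_hom L M = {\<phi> \<in> L \<rightarrow> M. monotone_on L proj_le proj_le \<phi>}"

section \<open>Operator algebras and their modules\<close>

definition op_subspace :: "('a::complex_hilbert \<Rightarrow>\<^sub>L 'a) set \<Rightarrow> bool"
  where "op_subspace \<U> \<longleftrightarrow> \<U> \<subseteq> bounded_ops \<and> complex_vector.subspace \<U>"

definition unital_op_algebra :: "('a::complex_hilbert \<Rightarrow>\<^sub>L 'a) set \<Rightarrow> bool"
  where "unital_op_algebra \<A> \<longleftrightarrow> op_subspace \<A> \<and>
    (\<forall>S\<in>\<A>. \<forall>T\<in>\<A>. S o\<^sub>L T \<in> \<A>) \<and> id_blinfun \<in> \<A>"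

definition rank_one_generated :: "('a::complex_hilbert \<Rightarrow>\<^sub>L 'a) set \<Rightarrow> bool"
  where "rank_one_generated \<A> \<longleftrightarrow>
    \<A> = sigma_weak closure_of complex_vector.span {R \<in> \<A>. rank_one R}"

definition right_submodule ::
    "('a::complex_hilbert \<Rightarrow>\<^sub>L 'a) set \<Rightarrow> ('a \<Rightarrow>\<^sub>L 'a) set \<Rightarrow> bool"
  where "right_submodule \<A> \<U> \<longleftrightarrow> op_subspace \<U> \<and> (\<forall>T\<in>\<U>. \<forall>S\<in>\<A>. T o\<^sub>L S \<in> \<U>)"

definition left_submodule ::
    "('a::complex_hilbert \<Rightarrow>\<^sub>L 'a) set \<Rightarrow> ('a \<Rightarrow>\<^sub>L 'a) set \<Rightarrow> bool"
  where "left_submodule \<A> \<U> \<longleftrightarrow> op_subspace \<U> \<and> (\<forall>T\<in>\<U>. \<forall>S\<in>\<A>. S o\<^sub>L T \<in> \<U>)"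

end

theory Submission
  imports Defs
begin

text \<open>
  The homomorphisms are the evident ones: \<open>\<phi> E\<close> is the projection onto the closed span of
  \<open>\<U> E\<close> (\<open>module_image\<close>) and \<open>\<psi> E\<close> the projection onto \<open>{x. \<U> x \<subseteq> E}\<close>
  (\<open>module_preimage\<close>). They are monotone and \<open>\<U>\<close> is contained in the set that they define. What
  needs proof is that an operator \<open>T\<close> satisfying all the inclusions lies in \<open>\<U>\<close>.

  Since \<open>\<A>\<close> contains the identity and is generated by its rank-one operators, the identity is a
  sigma-weak limit of sums of rank-one operators \<open>R \<in> \<A>\<close>. Multiplication by \<open>T\<close> on either side is
  sigma-weakly continuous and \<open>\<U>\<close> is a closed subspace, so it suffices to place \<open>T R\<close> (for a right
  module) or \<open>R T\<close> (for a left module) in \<open>\<U>\<close>; this is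
  \<open>image_of_identity_in_closed_subspace\<close>. For one rank-one operator, a single invariant
  projection decides:

  \<^item> Let \<open>\<U>\<close> be a right module and let \<open>x\<close> span the range of \<open>R\<close>. For \<open>E\<close> the closure of \<open>\<A> x\<close>, the
    inclusion \<open>\<U> \<A> \<subseteq> \<U>\<close> makes \<open>\<phi> E\<close> the closure of \<open>\<U> x\<close>. Hence \<open>T x\<close> is a limit of vectors
    \<open>S x\<close> with \<open>S \<in> \<U>\<close>. As \<open>R\<close> sees only \<open>x\<close>, the operators \<open>S R \<in> \<U>\<close> tend to \<open>T R\<close> in norm
    (\<open>compose_rank_one_in_closure\<close>).

  \<^item> Let \<open>\<U>\<close> be a left module and \<open>R z = \<langle>z, y\<rangle> x\<close>. For \<open>E\<close> the orthogonal complement of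
    \<open>\<A>\<^sup>* y\<close>, the inclusion \<open>\<A> \<U> \<subseteq> \<U>\<close> makes \<open>\<psi> E\<close> the orthogonal complement of \<open>\<U>\<^sup>* y\<close>. That \<open>T\<close> maps
    \<open>\<psi> E\<close> into \<open>E\<close> forces \<open>T\<^sup>* y\<close> into the closure of \<open>\<U>\<^sup>* y\<close>
    (\<open>functional_approximation\<close>), so operators \<open>R S \<in> \<U>\<close> tend to \<open>R T\<close> in norm
    (\<open>rank_one_compose_in_closure\<close>).

  Norm limits stay in \<open>\<U>\<close> because sigma-weakly closed sets are norm closed. The adjoints and
  the orthogonal projections come from the Hilbert space projection theorem and the Riesz
  representation, which are derived from completeness and the parallelogram law.
\<close>

section \<open>Orthogonal decomposition and the Riesz representation\<close>

text \<open>
  Points of \<open>V\<close> that nearly realise the distance \<open>infdist x V\<close> are close to each other, by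
  the parallelogram law applied to the midpoint, which again lies in \<open>V\<close>.
\<close>

lemma almost_nearest_points_close:
  fixes V :: "'a::real_inner set"
  assumes V: "subspace V" and u: "u \<in> V" and v: "v \<in> V"
    and du: "(dist x u)\<^sup>2 \<le> (infdist x V)\<^sup>2 + a" and dv: "(dist x v)\<^sup>2 \<le> (infdist x V)\<^sup>2 + a"
  shows "(dist u v)\<^sup>2 \<le> 4 * a"
proof -
  let ?m = "(1/2) *\<^sub>R (u + v)"
  have "?m \<in> V" using V u v by (intro subspace_scale subspace_add) auto
  then have "infdist x V \<le> dist x ?m" by (rule infdist_le)
  then have "(infdist x V)\<^sup>2 \<le> (dist x ?m)\<^sup>2" by (simp add: infdist_nonneg power_mono)
  moreover have "(dist u v)\<^sup>2 + 4 * (dist x ?m)\<^sup>2 = 2 * (dist x u)\<^sup>2 + 2 * (dist x v)\<^sup>2"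
    unfolding dist_norm power2_norm_eq_inner
    by (simp add: algebra_simps inner_diff_left inner_diff_right inner_add_left inner_add_right
        inner_commute)
  ultimately show ?thesis using du dv by linarith
qed

lemma nearest_point_exists:
  fixes V :: "'a::{real_inner, complete_space} set"
  assumes V: "subspace V" and cl: "closed V"
  shows "\<exists>p\<in>V. \<forall>v\<in>V. dist x p \<le> dist x v"
proof -
  let ?d = "infdist x V"
  have ne: "V \<noteq> {}" using subspace_0[OF V] by auto
  have "\<exists>u\<in>V. (dist x u)\<^sup>2 \<le> ?d\<^sup>2 + 1 / real (Suc n)" for n
  proof -
    have "?d < sqrt (?d\<^sup>2 + 1 / real (Suc n))"
      by (rule real_less_rsqrt) simp
    then obtain u where u: "u \<in> V" "dist x u < sqrt (?d\<^sup>2 + 1 / real (Suc n))"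
      unfolding infdist_notempty[OF ne] by (subst (asm) cINF_less_iff) (auto simp: ne)
    then have "(dist x u)\<^sup>2 \<le> (sqrt (?d\<^sup>2 + 1 / real (Suc n)))\<^sup>2"
      by (intro power_mono) auto
    then show ?thesis using u by auto
  qed
  then obtain u where u: "\<And>n. u n \<in> V"
    and du: "\<And>n. (dist x (u n))\<^sup>2 \<le> ?d\<^sup>2 + 1 / real (Suc n)" by metis
  have "Cauchy u"
  proof (rule metric_CauchyI)
    fix e :: real assume "e > 0"
    then obtain N where N: "inverse (real (Suc N)) < e\<^sup>2 / 4"
      using reals_Archimedean[of "e\<^sup>2/4"] by auto
    have "dist (u m) (u n) < e" if "m \<ge> N" "n \<ge> N" for m n
    proof -
      have "(dist x (u k))\<^sup>2 \<le> ?d\<^sup>2 + 1 / real (Suc N)" if "k \<ge> N" for k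
        using du[of k] that by (smt (verit) frac_le of_nat_0_less_iff of_nat_mono Suc_le_mono zero_less_Suc)
      then have "(dist (u m) (u n))\<^sup>2 \<le> 4 * (1 / real (Suc N))"
        using almost_nearest_points_close[OF V u u] that by blast
      also have "\<dots> < e\<^sup>2" using N by (simp add: inverse_eq_divide)
      finally show ?thesis using \<open>e > 0\<close> by (simp add: power_less_imp_less_base)
    qed
    then show "\<exists>N. \<forall>m\<ge>N. \<forall>n\<ge>N. dist (u m) (u n) < e" by blast
  qed
  then obtain p where p: "u \<longlonglongrightarrow> p" by (metis Cauchy_convergent_iff convergent_def)
  have "p \<in> V" using cl u p by (metis closed_sequentially)
  have "(dist x p)\<^sup>2 \<le> ?d\<^sup>2"
  proof (rule LIMSEQ_le)
    show "(\<lambda>n. (dist x (u n))\<^sup>2) \<longlonglongrightarrow> (dist x p)\<^sup>2" using p by (intro tendsto_intros)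
    show "(\<lambda>n. ?d\<^sup>2 + 1 / real (Suc n)) \<longlonglongrightarrow> ?d\<^sup>2"
      using tendsto_add[OF tendsto_const LIMSEQ_inverse_real_of_nat, of "?d\<^sup>2"]
      by (simp add: inverse_eq_divide)
  qed (use du in auto)
  then have "dist x p \<le> ?d" by (rule power2_le_imp_le[OF _ infdist_nonneg])
  then show ?thesis using \<open>p \<in> V\<close> infdist_le order_trans by blast
qed

lemma orthogonal_decomposition:
  fixes V :: "'a::{real_inner, complete_space} set"
  assumes V: "subspace V" and cl: "closed V"
  shows "\<exists>p\<in>V. \<forall>v\<in>V. inner (x - p) v = 0"
proof -
  obtain p where p: "p \<in> V" "\<And>v. v \<in> V \<Longrightarrow> dist x p \<le> dist x v"
    using nearest_point_exists[OF assms] by blast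
  have "inner (x - p) v = 0" if v: "v \<in> V" for v
  proof (cases "v = 0")
    case False
    \<comment> \<open>Moving \<open>p\<close> along \<open>v\<close> by the optimal amount \<open>t\<close> would decrease the distance if \<open>x - p\<close> and \<open>v\<close> were not orthogonal.\<close>
    define t where "t = inner (x - p) v / inner v v"
    have vv: "inner v v > 0" using False by simp
    have "p + t *\<^sub>R v \<in> V" using V p v by (intro subspace_add subspace_scale) auto
    then have "(dist x p)\<^sup>2 \<le> (dist x (p + t *\<^sub>R v))\<^sup>2" using p by (intro power_mono) auto
    moreover have "x - (p + t *\<^sub>R v) = (x - p) - t *\<^sub>R v" by simp
    ultimately have "inner (x - p) (x - p) \<le> inner ((x - p) - t *\<^sub>R v) ((x - p) - t *\<^sub>R v)"
      unfolding dist_norm power2_norm_eq_inner by metis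
    also have "\<dots> = inner (x - p) (x - p) - 2 * t * inner (x - p) v + t * (t * inner v v)"
      by (simp add: inner_diff_left[of "x - p"] inner_diff_right[of _ "x - p"] inner_commute)
    also have "t * inner v v = inner (x - p) v" using vv by (simp add: t_def)
    finally have "t * inner (x - p) v \<le> 0" by linarith
    then have "(inner (x - p) v)\<^sup>2 / inner v v \<le> 0" by (simp add: t_def power2_eq_square)
    then show ?thesis using vv by (simp add: divide_le_0_iff)
  qed simp
  then show ?thesis using p by blast
qed

lemma riesz_representation:
  fixes f :: "'a::{real_inner, complete_space} \<Rightarrow> real"
  assumes "bounded_linear f"
  shows "\<exists>y. \<forall>x. f x = inner x y"
proof (cases "\<forall>x. f x = 0")
  case True
  then show ?thesis by (intro exI[of _ 0]) simp
next
  case False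
  interpret f: bounded_linear f by fact
  obtain x where x: "f x \<noteq> 0" using False by blast
  have "subspace {z. f z = 0}" by (auto simp: subspace_def f.add f.scaleR f.zero)
  moreover have "closed {z. f z = 0}"
    by (intro closed_Collect_eq f.continuous_on continuous_on_const continuous_on_id)
  ultimately obtain p where p: "f p = 0" "\<And>v. f v = 0 \<Longrightarrow> inner (x - p) v = 0"
    using orthogonal_decomposition[of "{z. f z = 0}" x] by blast
  let ?w = "x - p"
  have fw: "f ?w \<noteq> 0" using x p by (simp add: f.diff)
  then have ww: "inner ?w ?w \<noteq> 0" using f.zero by (metis inner_eq_zero_iff)
  have "f z = inner z ((f ?w / inner ?w ?w) *\<^sub>R ?w)" for z
  proof -
    have "f (z - (f z / f ?w) *\<^sub>R ?w) = 0" using fw by (simp only: f.diff[of z] f.scaleR) simp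
    then have "inner ?w (z - (f z / f ?w) *\<^sub>R ?w) = 0" by (rule p)
    then have "inner ?w z = (f z / f ?w) * inner ?w ?w" by (simp only: inner_diff_right[of _ z] inner_scaleR_right)
    then show ?thesis using fw ww by (simp only: inner_scaleR_right inner_commute[of z]) simp
  qed
  then show ?thesis by blast
qed

section \<open>Complex inner products, subspaces and projections\<close>

lemma cinner_eq_inner: "cinner x y = Complex (inner x y) (- inner (\<i> *\<^sub>C x) y)"
  by (rule complex_eqI) (simp_all add: inner_eq_Re_cinner cinner_scaleC_left)

lemma cinner_add_right: "cinner x (y + z) = cinner x y + cinner x z"
  by (metis cinner_add_left cinner_commute complex_cnj_add)

lemma cinner_scaleC_right: "cinner x (c *\<^sub>C y) = cnj c * cinner x y"
  by (metis cinner_scaleC_left cinner_commute complex_cnj_mult)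

lemma cinner_diff_left: "cinner (x - y) z = cinner x z - cinner y z"
  by (metis cinner_add_left add_diff_cancel diff_add_cancel)

lemma cinner_diff_right: "cinner x (y - z) = cinner x y - cinner x z"
  by (metis cinner_add_right add_diff_cancel diff_add_cancel)

lemma cinner_zero_left [simp]: "cinner 0 x = 0"
  using cinner_diff_left[of 0 0 x] by simp

lemma cinner_zero_right [simp]: "cinner x 0 = 0"
  using cinner_diff_right[of x 0 0] by simp

lemma cinner_self_eq_0: "cinner x x = 0 \<Longrightarrow> x = 0"
  by (simp add: cinner_self)

lemma norm_cinner_le: "norm (cinner x y) \<le> norm x * norm y"
proof (cases "cinner x y = 0")
  case False
  \<comment> \<open>Rotating \<open>x\<close> by a phase makes the complex inner product real and positive.\<close>
  define c where "c = cnj (sgn (cinner x y))"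
  have "cinner (c *\<^sub>C x) y = of_real (norm (cinner x y))"
  proof -
    have "cnj z * z = of_real (norm z) * of_real (norm z)" for z
      by (metis complex_norm_square mult.commute power2_eq_square of_real_mult)
    then show ?thesis using False by (simp add: cinner_scaleC_left c_def sgn_eq)
  qed
  then have "norm (cinner x y) = inner (c *\<^sub>C x) y" by (simp add: inner_eq_Re_cinner)
  also have "\<dots> \<le> norm (c *\<^sub>C x) * norm y" by (rule norm_cauchy_schwarz)
  also have "norm (c *\<^sub>C x) = norm x" using False by (simp add: norm_scaleC c_def norm_sgn)
  finally show ?thesis .
qed simp

lemma bounded_linear_scaleC: "bounded_linear (\<lambda>x::'a::complex_hilbert. c *\<^sub>C x)"
proof (rule bounded_linear_intro)
  fix x y :: 'a and r :: real
  show "c *\<^sub>C (x + y) = c *\<^sub>C x + c *\<^sub>C y" by (rule scaleC_add_right)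
  show "c *\<^sub>C (r *\<^sub>R x) = r *\<^sub>R (c *\<^sub>C x)"
    by (simp add: scaleR_scaleC scaleC_scaleC mult.commute)
  show "norm (c *\<^sub>C x) \<le> norm x * cmod c" by (simp add: norm_scaleC)
qed

lemma bounded_linear_cinner_left: "bounded_linear (\<lambda>x::'a::complex_hilbert. cinner x y)"
proof (rule bounded_linear_intro)
  fix x z :: 'a and r :: real
  show "cinner (x + z) y = cinner x y + cinner z y" by (rule cinner_add_left)
  show "cinner (r *\<^sub>R x) y = r *\<^sub>R cinner x y"
    by (simp add: scaleR_scaleC[of r x] cinner_scaleC_left scaleR_conv_of_real)
  show "norm (cinner x y) \<le> norm x * norm y" by (rule norm_cinner_le)
qed

lemma complex_subspace_imp_subspace:
  "complex_vector.subspace V \<Longrightarrow> subspace V"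
  by (auto simp: subspace_def complex_vector.subspace_def scaleR_scaleC)

lemma complex_subspace_closure:
  fixes V :: "'a::complex_hilbert set"
  assumes V: "complex_vector.subspace V"
  shows "complex_vector.subspace (closure V)"
proof (rule complex_vector.subspaceI)
  show "0 \<in> closure V"
    using complex_vector.subspace_0[OF V] closure_subset by blast
next
  fix x y assume "x \<in> closure V" "y \<in> closure V"
  then obtain a b where "\<And>n. a n \<in> V" "a \<longlonglongrightarrow> x" "\<And>n. b n \<in> V" "b \<longlonglongrightarrow> y"
    unfolding closure_sequential by blast
  then have "\<And>n. a n + b n \<in> V" "(\<lambda>n. a n + b n) \<longlonglongrightarrow> x + y"
    by (auto intro: complex_vector.subspace_add[OF V] tendsto_add)
  then show "x + y \<in> closure V"
    unfolding closure_sequential by (intro exI[of _ "\<lambda>n. a n + b n"]) simp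
next
  fix c x assume x: "x \<in> closure V"
  have "(\<lambda>x. c *\<^sub>C x) ` closure V \<subseteq> closure V"
  proof (rule image_closure_subset)
    show "continuous_on (closure V) (\<lambda>x. c *\<^sub>C x)"
      by (intro linear_continuous_on bounded_linear_scaleC)
    show "(\<lambda>x. c *\<^sub>C x) ` V \<subseteq> closure V"
      using complex_vector.subspace_scale[OF V] closure_subset by blast
  qed simp
  then show "c *\<^sub>C x \<in> closure V" using x by blast
qed

lemma complex_orthogonal_decomposition:
  fixes V :: "'a::complex_hilbert set"
  assumes V: "complex_vector.subspace V" and cl: "closed V"
  shows "\<exists>p\<in>V. \<forall>v\<in>V. cinner (x - p) v = 0"
proof -
  obtain p where p: "p \<in> V" "\<And>v. v \<in> V \<Longrightarrow> inner (x - p) v = 0"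
    using orthogonal_decomposition[OF complex_subspace_imp_subspace[OF V] cl] by blast
  have "cinner v (x - p) = 0" if "v \<in> V" for v
    using p(2)[OF that] p(2)[OF complex_vector.subspace_scale[OF V that, of \<i>]]
    by (simp add: cinner_eq_inner inner_commute complex_eq_iff)
  then have "cinner (x - p) v = 0" if "v \<in> V" for v
    using cinner_commute[of "x - p" v] that by simp
  then show ?thesis using p by blast
qed

text \<open>
  The real Riesz representation gives the adjoint with respect to the real part of the inner
  product; complex linearity of \<open>T\<close> extends the identity to the imaginary part. The norm bound is
  what makes the adjoint preserve square summability.
\<close>

lemma adjoint_exists:
  fixes T :: "'a::complex_hilbert \<Rightarrow>\<^sub>L 'a"
  assumes T: "T \<in> bounded_ops"
  shows "\<exists>T'. (\<forall>x y. cinner (T x) y = cinner x (T' y)) \<and> (\<forall>y. norm (T' y) \<le> norm T * norm y)"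
proof -
  have "\<exists>w. (\<forall>x. cinner (T x) y = cinner x w) \<and> norm w \<le> norm T * norm y" for y
  proof -
    have "bounded_linear (\<lambda>x. inner (T x) y)"
      by (rule bounded_linear_inner_left_comp[OF blinfun.bounded_linear_right])
    then obtain w where w: "\<And>x. inner (T x) y = inner x w"
      using riesz_representation by blast
    have eq: "cinner (T x) y = cinner x w" for x
      using T w[of x] w[of "\<i> *\<^sub>C x"] by (simp add: cinner_eq_inner bounded_ops_def)
    have "norm w * norm w = inner (T w) y"
      using w[of w] by (simp add: power2_norm_eq_inner flip: power2_eq_square)
    also have "\<dots> \<le> norm (T w) * norm y" by (rule norm_cauchy_schwarz)
    also have "\<dots> \<le> norm T * norm w * norm y" by (intro mult_right_mono norm_blinfun) simp
    finally have "norm w * norm w \<le> (norm T * norm y) * norm w" by (simp add: mult_ac)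
    then have "norm w \<le> norm T * norm y"
      by (cases "norm w = 0") (auto simp: mult_le_cancel_right)
    then show ?thesis using eq by blast
  qed
  then show ?thesis by metis
qed

lemma projection_onto_exists:
  fixes V :: "'a::complex_hilbert set"
  assumes V: "complex_vector.subspace V" and cl: "closed V"
  shows "\<exists>E\<in>projections. range (blinfun_apply E) = V"
proof -
  obtain P where PV: "\<And>x. P x \<in> V" and orth: "\<And>x v. v \<in> V \<Longrightarrow> cinner (x - P x) v = 0"
    using complex_orthogonal_decomposition[OF V cl] by metis
  note V_add = complex_vector.subspace_add[OF V]
    and V_scale = complex_vector.subspace_scale[OF V]
    and V_diff = complex_vector.subspace_diff[OF V]
  have unique: "P x = p" if p: "p \<in> V" and "\<And>v. v \<in> V \<Longrightarrow> cinner (x - p) v = 0" for x p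
  proof -
    have d: "P x - p \<in> V" using PV p by (rule V_diff)
    have "cinner ((x - p) - (x - P x)) (P x - p) = 0"
      unfolding cinner_diff_left[of "x - p"] using orth[OF d] that(2)[OF d] by simp
    then show ?thesis using cinner_self_eq_0[of "P x - p"] by simp
  qed
  have add: "P (x + y) = P x + P y" for x y
  proof (rule unique)
    fix v assume v: "v \<in> V"
    have "x + y - (P x + P y) = (x - P x) + (y - P y)" by simp
    then show "cinner (x + y - (P x + P y)) v = 0"
      using orth[OF v] cinner_add_left by (metis add_0)
  qed (simp add: PV V_add)
  have scale: "P (c *\<^sub>C x) = c *\<^sub>C P x" for c x
  proof (rule unique)
    fix v assume v: "v \<in> V"
    have "c *\<^sub>C x - c *\<^sub>C P x = c *\<^sub>C (x - P x)"
      by (simp add: complex_vector.scale_right_diff_distrib)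
    then show "cinner (c *\<^sub>C x - c *\<^sub>C P x) v = 0"
      using orth[OF v] by (simp add: cinner_scaleC_left)
  qed (simp add: PV V_scale)
  have sa: "cinner (P x) y = cinner x (P y)" for x y
  proof -
    have "cinner (P x) (y - P y) = 0"
      using orth[OF PV, of y x] cinner_commute[of "P x" "y - P y"] by simp
    then show ?thesis using orth[OF PV, of x y] by (simp add: cinner_diff_left cinner_diff_right)
  qed
  have bl: "bounded_linear P"
  proof (rule bounded_linear_intro)
    fix x y and r :: real
    show "P (x + y) = P x + P y" by (rule add)
    show "P (r *\<^sub>R x) = r *\<^sub>R P x" by (simp add: scaleR_scaleC scale)
    have "cinner x (P x) = cinner (P x) (P x)"
      using orth[OF PV, of x x] by (simp add: cinner_diff_left)
    then have "norm (P x) * norm (P x) = inner x (P x)"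
      by (simp add: inner_eq_Re_cinner cinner_self flip: power2_eq_square)
    also have "\<dots> \<le> norm x * norm (P x)" by (rule norm_cauchy_schwarz)
    finally show "norm (P x) \<le> norm x * 1"
      by (cases "norm (P x) = 0") (auto simp: mult_le_cancel_right)
  qed
  have P_id: "P v = v" if "v \<in> V" for v
    by (rule unique) (auto simp: that cinner_diff_left)
  have app: "blinfun_apply (Blinfun P) = P" using bl by (rule bounded_linear_Blinfun_apply)
  have "Blinfun P \<in> projections"
    by (auto simp: projections_def bounded_ops_def app scale sa intro!: blinfun_eqI P_id PV)
  moreover have "range (blinfun_apply (Blinfun P)) = V"
    unfolding app using PV P_id by (metis image_subset_iff rangeI subsetI subset_antisym)
  ultimately show ?thesis by blast
qed

definition projection_onto :: "'a::complex_hilbert set \<Rightarrow> ('a \<Rightarrow>\<^sub>L 'a)"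
  where "projection_onto V = (SOME E. E \<in> projections \<and> range (blinfun_apply E) = V)"

lemma
  fixes V :: "'a::complex_hilbert set"
  assumes "complex_vector.subspace V" "closed V"
  shows projection_onto: "projection_onto V \<in> projections"
    and range_projection_onto: "range (blinfun_apply (projection_onto V)) = V"
proof -
  have "\<exists>E. E \<in> projections \<and> range (blinfun_apply E) = V"
    using projection_onto_exists[OF assms] by blast
  from someI_ex[OF this]
  show "projection_onto V \<in> projections" "range (blinfun_apply (projection_onto V)) = V"
    by (simp_all add: projection_onto_def)
qed

lemma
  fixes E :: "'a::complex_hilbert \<Rightarrow>\<^sub>L 'a"
  assumes "E \<in> projections"
  shows subspace_range_projection: "complex_vector.subspace (range (blinfun_apply E))"
    and closed_range_projection: "closed (range (blinfun_apply E))"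
proof -
  have "E (E x) = E x" for x
    using assms by (metis (mono_tags, lifting) blinfun_apply_blinfun_compose mem_Collect_eq projections_def)
  then have *: "range (blinfun_apply E) = {x. E x = x}" by (auto intro: range_eqI[OF sym])
  show "complex_vector.subspace (range (blinfun_apply E))"
    unfolding * using assms
    by (auto simp: complex_vector.subspace_def blinfun.add_right projections_def bounded_ops_def)
  show "closed (range (blinfun_apply E))"
    unfolding * by (intro closed_Collect_eq continuous_intros)
qed


section \<open>Continuity in the sigma-weak topology\<close>

lemma sq_summable_bound:
  assumes x: "sq_summable x" and le: "\<And>n. norm (w n) \<le> K * norm (x n)"
  shows "sq_summable w"
  unfolding sq_summable_def
proof (rule summable_comparison_test'[of "\<lambda>n. K\<^sup>2 * (norm (x n))\<^sup>2" 0])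
  show "summable (\<lambda>n. K\<^sup>2 * (norm (x n))\<^sup>2)"
    using x unfolding sq_summable_def by (rule summable_mult)
  show "norm ((norm (w n))\<^sup>2) \<le> K\<^sup>2 * (norm (x n))\<^sup>2" for n
    using power_mono[OF le[of n] norm_ge_zero, of 2] by (simp add: power_mult_distrib)
qed

lemma summable_norm_mult_norm:
  assumes x: "sq_summable x" and y: "sq_summable y"
  shows "summable (\<lambda>n. norm (x n) * norm (y n))"
proof (rule summable_comparison_test'[of "\<lambda>n. (norm (x n))\<^sup>2 + (norm (y n))\<^sup>2" 0])
  show "summable (\<lambda>n. (norm (x n))\<^sup>2 + (norm (y n))\<^sup>2)"
    using x y unfolding sq_summable_def by (rule summable_add)
  fix n
  have "0 \<le> norm (x n) * norm (y n)" by simp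
  then show "norm (norm (x n) * norm (y n)) \<le> (norm (x n))\<^sup>2 + (norm (y n))\<^sup>2"
    using sum_squares_bound[of "norm (x n)" "norm (y n)"]
    by (simp only: real_norm_def abs_of_nonneg)
qed

lemma bounded_linear_sigma_weak_functional:
  fixes x y :: "nat \<Rightarrow> 'a::complex_hilbert"
  assumes x: "sq_summable x" and y: "sq_summable y"
  shows "bounded_linear (sigma_weak_functional x y)"
proof (rule bounded_linear_intro)
  let ?K = "\<Sum>n. norm (x n) * norm (y n)"
  note K = summable_norm_mult_norm[OF x y]
  have le: "norm (cinner (T (x n)) (y n)) \<le> norm T * (norm (x n) * norm (y n))"
    for T :: "'a \<Rightarrow>\<^sub>L 'a" and n
    using norm_cinner_le[of "T (x n)" "y n"]
      mult_right_mono[OF norm_blinfun[of T "x n"] norm_ge_zero[of "y n"]]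
    by (simp add: mult_ac)
  have nsum: "summable (\<lambda>n. norm (cinner (T (x n)) (y n)))" for T :: "'a \<Rightarrow>\<^sub>L 'a"
    by (rule summable_comparison_test'[OF summable_mult[OF K, of "norm T"], of 0]) (simp add: le)
  note sum = summable_norm_cancel[OF nsum]
  interpret ci: bounded_linear "\<lambda>x::'a. cinner x u" for u by (rule bounded_linear_cinner_left)
  fix S T :: "'a \<Rightarrow>\<^sub>L 'a" and r :: real
  show "sigma_weak_functional x y (S + T) = sigma_weak_functional x y S + sigma_weak_functional x y T"
    unfolding sigma_weak_functional_def
    by (simp add: suminf_add[OF sum sum] blinfun.add_left ci.add)
  show "sigma_weak_functional x y (r *\<^sub>R T) = r *\<^sub>R sigma_weak_functional x y T"
    unfolding sigma_weak_functional_def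
    by (simp add: suminf_scaleR_right[OF sum] blinfun.scaleR_left ci.scaleR)
  have "norm (sigma_weak_functional x y T) \<le> (\<Sum>n. norm (cinner (T (x n)) (y n)))"
    unfolding sigma_weak_functional_def by (rule summable_norm[OF nsum])
  also have "\<dots> \<le> (\<Sum>n. norm T * (norm (x n) * norm (y n)))"
    by (rule suminf_le[OF le nsum summable_mult[OF K]])
  also have "\<dots> = norm T * ?K" by (rule suminf_mult[OF K])
  finally show "norm (sigma_weak_functional x y T) \<le> norm T * ?K" .
qed

lemma continuous_map_sigma_weakI:
  fixes m :: "'b \<Rightarrow> 'a::complex_hilbert \<Rightarrow>\<^sub>L 'a"
  assumes m: "m \<in> topspace X \<rightarrow> bounded_ops"
    and f: "\<And>x y. sq_summable x \<Longrightarrow> sq_summable y \<Longrightarrow>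
      continuous_map X euclidean (\<lambda>t. sigma_weak_functional x y (m t))"
  shows "continuous_map X sigma_weak m"
  unfolding sigma_weak_def
proof (rule continuous_on_generated_topo)
  fix W :: "('a \<Rightarrow>\<^sub>L 'a) set"
  assume "W \<in> {{T \<in> bounded_ops. sigma_weak_functional x y T \<in> V} | x y V.
      sq_summable x \<and> sq_summable y \<and> open V}"
  then obtain x y V where W: "W = {T \<in> bounded_ops. sigma_weak_functional x y T \<in> V}"
    and xy: "sq_summable x" "sq_summable y" and V: "open V" by blast
  have "openin X {t \<in> topspace X. sigma_weak_functional x y (m t) \<in> V}"
    using openin_continuous_map_preimage[OF f[OF xy], of V] V by simp
  also have "{t \<in> topspace X. sigma_weak_functional x y (m t) \<in> V} = m -` W \<inter> topspace X"
    using m by (auto simp: W)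
  finally show "openin X (m -` W \<inter> topspace X)" .
next
  have "m ` topspace X \<subseteq> topspace sigma_weak"
    using m by (auto simp: topspace_sigma_weak)
  then show "m ` topspace X \<subseteq> \<Union> {{T \<in> bounded_ops. sigma_weak_functional x y T \<in> V} | x y V.
      sq_summable x \<and> sq_summable y \<and> open V}"
    by (simp only: sigma_weak_def topology_generated_by_topspace)
qed

lemma continuous_map_sigma_weak_functional:
  assumes "sq_summable x" "sq_summable y"
  shows "continuous_map sigma_weak euclidean (sigma_weak_functional x y)"
  unfolding continuous_map_def topspace_sigma_weak
proof (intro conjI allI impI)
  fix V :: "complex set" assume "openin euclidean V"
  then show "openin sigma_weak {T \<in> bounded_ops. sigma_weak_functional x y T \<in> V}"
    unfolding sigma_weak_def using assms by (intro topology_generated_by_Basis) auto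
qed simp

text \<open>Each \<open>sigma_weak_functional\<close> is norm continuous, so the norm topology is finer.\<close>

lemma norm_closure_in_sigma_weak_closed:
  assumes cl: "closedin sigma_weak \<U>" and T: "T \<in> bounded_ops" "T \<in> closure \<U>"
  shows "T \<in> \<U>"
proof -
  have "continuous_map (top_of_set bounded_ops) sigma_weak (\<lambda>T. T)"
    by (rule continuous_map_sigma_weakI)
      (auto intro!: linear_continuous_on bounded_linear_sigma_weak_functional)
  then have "closedin (top_of_set bounded_ops) {T \<in> bounded_ops. T \<in> \<U>}"
    using closedin_continuous_map_preimage[OF _ cl] by fastforce
  then obtain C where "closed C" and C: "{T \<in> bounded_ops. T \<in> \<U>} = bounded_ops \<inter> C"
    by (auto simp: closedin_closed)
  have "\<U> \<subseteq> bounded_ops" using closedin_subset[OF cl] by (simp add: topspace_sigma_weak)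
  then have "\<U> \<subseteq> C" using C by blast
  then have "closure \<U> \<subseteq> C" using \<open>closed C\<close> by (rule closure_minimal)
  then show ?thesis using T C by blast
qed

lemma compose_in_bounded_ops:
  "S \<in> bounded_ops \<Longrightarrow> T \<in> bounded_ops \<Longrightarrow> S o\<^sub>L T \<in> bounded_ops"
  by (simp add: bounded_ops_def)

lemma continuous_map_sigma_weak_compose_right:
  assumes T: "T \<in> bounded_ops"
  shows "continuous_map sigma_weak sigma_weak (\<lambda>F. F o\<^sub>L T)"
proof (rule continuous_map_sigma_weakI)
  fix x y :: "nat \<Rightarrow> 'a" assume x: "sq_summable x" and y: "sq_summable y"
  have "sq_summable (\<lambda>n. T (x n))" using x norm_blinfun by (rule sq_summable_bound)
  from continuous_map_sigma_weak_functional[OF this y]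
  show "continuous_map sigma_weak euclidean (\<lambda>F. sigma_weak_functional x y (F o\<^sub>L T))"
    by (simp add: sigma_weak_functional_def[abs_def])
qed (auto simp: topspace_sigma_weak intro: compose_in_bounded_ops T)

text \<open>On this side the functionals pull back through the adjoint of \<open>T\<close>.\<close>

lemma continuous_map_sigma_weak_compose_left:
  assumes T: "T \<in> bounded_ops"
  shows "continuous_map sigma_weak sigma_weak (\<lambda>F. T o\<^sub>L F)"
proof (rule continuous_map_sigma_weakI)
  fix x y :: "nat \<Rightarrow> 'a" assume x: "sq_summable x" and y: "sq_summable y"
  obtain T' where T': "\<And>x y. cinner (T x) y = cinner x (T' y)"
    and le: "\<And>y. norm (T' y) \<le> norm T * norm y"
    using adjoint_exists[OF T] by blast
  have "sq_summable (\<lambda>n. T' (y n))" using y le by (rule sq_summable_bound)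
  from continuous_map_sigma_weak_functional[OF x this]
  show "continuous_map sigma_weak euclidean (\<lambda>F. sigma_weak_functional x y (T o\<^sub>L F))"
    by (simp add: sigma_weak_functional_def[abs_def] T')
qed (auto simp: topspace_sigma_weak intro: compose_in_bounded_ops T)

section \<open>Reduction to rank-one factors\<close>

text \<open>
  The identity is a sigma-weak limit of finite sums of rank-one operators of \<open>\<A>\<close>. Applied with
  \<open>m F = T o\<^sub>L F\<close> or \<open>m F = F o\<^sub>L T\<close>, this reduces membership of \<open>T\<close> in a module to that of
  its products with rank-one operators.
\<close>

lemma image_of_identity_in_closed_subspace:
  assumes A: "unital_op_algebra \<A>" "rank_one_generated \<A>"
    and U: "complex_vector.subspace \<U>" "closedin sigma_weak \<U>"
    and m: "continuous_map sigma_weak sigma_weak m"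
    and add: "\<And>F G. m (F + G) = m F + m G" and scale: "\<And>c F. m (c *\<^sub>C F) = c *\<^sub>C m F"
    and rank_one: "\<And>R. R \<in> \<A> \<Longrightarrow> rank_one R \<Longrightarrow> m R \<in> \<U>"
  shows "m id_blinfun \<in> \<U>"
proof -
  let ?B = "{R \<in> \<A>. rank_one R}"
  have "m 0 = 0" using add[of 0 0] by simp
  then have "complex_vector.subspace (m -` \<U>)"
    using U(1) by (simp add: complex_vector.subspace_def add scale)
  then have "complex_vector.span ?B \<subseteq> m -` \<U>"
    using rank_one by (intro complex_vector.span_minimal) auto
  then have "m ` (complex_vector.span ?B) \<subseteq> \<U>" by blast
  then have "sigma_weak closure_of (m ` complex_vector.span ?B) \<subseteq> \<U>"
    using U(2) by (rule closure_of_minimal)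
  moreover have "id_blinfun \<in> sigma_weak closure_of (complex_vector.span ?B)"
    using A unfolding unital_op_algebra_def rank_one_generated_def by blast
  ultimately show ?thesis
    using continuous_map_image_closure_subset[OF m] by blast
qed

lemma rank_one_range:
  assumes "rank_one R"
  shows "\<exists>x. x \<noteq> 0 \<and> x \<in> range (blinfun_apply R) \<and> (\<forall>z. \<exists>c. R z = c *\<^sub>C x)"
proof -
  obtain B where B: "B \<subseteq> range (blinfun_apply R)" "complex_vector.independent B"
    "range (blinfun_apply R) \<subseteq> complex_vector.span B" "card B = 1"
    using assms complex_vector.basis_exists[of "range (blinfun_apply R)"]
    unfolding rank_one_def by metis
  then obtain x where x: "B = {x}" by (auto simp: card_1_singleton_iff)
  have "x \<noteq> 0" using B(2) complex_vector.dependent_zero x by blast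
  moreover have "\<exists>c. R z = c *\<^sub>C x" for z
    using B(3) x by (force simp: complex_vector.span_singleton)
  ultimately show ?thesis using B(1) x by blast
qed

section \<open>Right modules\<close>

text \<open>
  On operators of the form \<open>S o\<^sub>L R\<close> norm convergence is convergence at the single vector \<open>x\<close>:
  \<open>\<parallel>(S - T) o\<^sub>L R\<parallel> \<le> \<parallel>(S - T) x\<parallel> * \<parallel>R\<parallel> / \<parallel>x\<parallel>\<close>.
\<close>

lemma compose_rank_one_in_closure:
  fixes R T :: "'a::complex_hilbert \<Rightarrow>\<^sub>L 'a"
  assumes R: "\<And>z. \<exists>c. blinfun_apply R z = c *\<^sub>C x" and x: "x \<noteq> 0" and U: "\<U> \<subseteq> bounded_ops"
    and T: "T \<in> bounded_ops" "blinfun_apply T x \<in> closure ((\<lambda>S. blinfun_apply S x) ` \<U>)"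
  shows "T o\<^sub>L R \<in> closure ((\<lambda>S. S o\<^sub>L R) ` \<U>)"
  unfolding closure_approachable
proof (intro allI impI)
  fix e :: real assume e: "e > 0"
  \<comment> \<open>The summand \<open>1\<close> keeps the denominator positive when \<open>R = 0\<close>.\<close>
  define d where "d = e * norm x / (norm R + 1)"
  have pos: "norm R + 1 > 0" using norm_ge_zero[of R] by linarith
  have "d > 0" using e x pos by (simp add: d_def)
  then obtain S where S: "S \<in> \<U>" "dist (S x) (T x) < d"
    using T(2) unfolding closure_approachable by blast
  have "norm ((S o\<^sub>L R) - (T o\<^sub>L R)) \<le> d / norm x * norm R"
  proof (rule norm_blinfun_bound)
    show "0 \<le> d / norm x * norm R" using \<open>d > 0\<close> by simp
    fix z
    obtain c where c: "R z = c *\<^sub>C x" using R by blast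
    have "norm (((S o\<^sub>L R) - (T o\<^sub>L R)) z) = norm (c *\<^sub>C (S x - T x))"
      using U S T(1) by (auto simp: bounded_ops_def blinfun.diff_left c
          complex_vector.scale_right_diff_distrib)
    also have "\<dots> = norm (R z) / norm x * dist (S x) (T x)"
      using x by (simp add: norm_scaleC c dist_norm)
    also have "\<dots> \<le> (norm R * norm z) / norm x * d"
      using S(2) by (intro mult_mono divide_right_mono norm_blinfun) auto
    finally show "norm (((S o\<^sub>L R) - (T o\<^sub>L R)) z) \<le> d / norm x * norm R * norm z"
      by (simp add: mult_ac)
  qed
  also have "\<dots> = e * (norm R / (norm R + 1))" using x by (simp add: d_def)
  also have "\<dots> < e * 1" using e pos by (intro mult_strict_left_mono) auto
  finally show "\<exists>y\<in>(\<lambda>S. S o\<^sub>L R) ` \<U>. dist y (T o\<^sub>L R) < e"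
    using S(1) by (auto simp: dist_norm)
qed

lemma subspace_evaluations:
  assumes "complex_vector.subspace \<U>"
  shows "complex_vector.subspace ((\<lambda>S. blinfun_apply S x) ` \<U>)"
proof (rule complex_vector.subspaceI)
  show "0 \<in> (\<lambda>S. blinfun_apply S x) ` \<U>"
    using complex_vector.subspace_0[OF assms] by (auto intro!: image_eqI[of _ _ 0])
  fix u assume u: "u \<in> (\<lambda>S. blinfun_apply S x) ` \<U>"
  show "c *\<^sub>C u \<in> (\<lambda>S. blinfun_apply S x) ` \<U>" for c
    using u complex_vector.subspace_scale[OF assms, of _ c]
    by (auto intro!: image_eqI[of _ _ "c *\<^sub>C S" for S] simp: scaleC_blinfun.rep_eq)
  fix v assume "v \<in> (\<lambda>S. blinfun_apply S x) ` \<U>"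
  then show "u + v \<in> (\<lambda>S. blinfun_apply S x) ` \<U>"
    using u complex_vector.subspace_add[OF assms]
    by (auto intro!: image_eqI[of _ _ "S + S'" for S S'] simp: blinfun.add_left)
qed

text \<open>The closure of \<open>\<A> x\<close> is the smallest closed invariant subspace containing \<open>x\<close>.\<close>

lemma
  fixes x :: "'a::complex_hilbert"
  assumes A: "unital_op_algebra \<A>"
  defines "V \<equiv> closure ((\<lambda>A. blinfun_apply A x) ` \<A>)"
  shows cyclic_projection_in_Lat: "projection_onto V \<in> Lat \<A>"
    and range_cyclic_projection: "range (blinfun_apply (projection_onto V)) = V"
    and in_cyclic_subspace: "x \<in> V"
proof -
  have sub: "complex_vector.subspace \<A>"
    and mult: "\<And>S T. S \<in> \<A> \<Longrightarrow> T \<in> \<A> \<Longrightarrow> S o\<^sub>L T \<in> \<A>" and one: "id_blinfun \<in> \<A>"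
    using A by (auto simp: unital_op_algebra_def op_subspace_def)
  have "complex_vector.subspace V" "closed V"
    unfolding V_def by (intro complex_subspace_closure subspace_evaluations sub closed_closure)+
  note V = projection_onto[OF this] range_projection_onto[OF this]
  show range: "range (blinfun_apply (projection_onto V)) = V" by (rule V)
  have "blinfun_apply B ` V \<subseteq> V" if B: "B \<in> \<A>" for B
    unfolding V_def
  proof (rule image_closure_subset)
    show "continuous_on (closure ((\<lambda>A. blinfun_apply A x) ` \<A>)) (blinfun_apply B)"
      by (intro continuous_intros)
    have "B (A x) \<in> (\<lambda>A. blinfun_apply A x) ` \<A>" if "A \<in> \<A>" for A
      using mult[OF B that] by (auto intro!: image_eqI[of _ _ "B o\<^sub>L A"])
    then show "blinfun_apply B ` (\<lambda>A. blinfun_apply A x) ` \<A>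
        \<subseteq> closure ((\<lambda>A. blinfun_apply A x) ` \<A>)"
      using closure_subset by blast
  qed simp
  then show "projection_onto V \<in> Lat \<A>"
    using V(1) by (auto simp: Lat_def maps_into_def range)
  have "x \<in> (\<lambda>A. blinfun_apply A x) ` \<A>" using one by (auto intro!: image_eqI[of _ _ id_blinfun])
  then show "x \<in> V" unfolding V_def by (rule subsetD[OF closure_subset])
qed

definition module_image :: "('a::complex_hilbert \<Rightarrow>\<^sub>L 'a) set \<Rightarrow> ('a \<Rightarrow>\<^sub>L 'a) \<Rightarrow> 'a set"
  where "module_image \<U> E = closure (complex_vector.span {blinfun_apply T x | T x. T \<in> \<U> \<and> x \<in> range (blinfun_apply E)})"

lemma
  shows subspace_module_image: "complex_vector.subspace (module_image \<U> E)"
    and closed_module_image: "closed (module_image \<U> E)"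
  by (simp_all add: module_image_def complex_subspace_closure complex_vector.subspace_span)

lemma apply_in_module_image:
  "T \<in> \<U> \<Longrightarrow> x \<in> range (blinfun_apply E) \<Longrightarrow> blinfun_apply T x \<in> module_image \<U> E"
  unfolding module_image_def
  by (rule subsetD[OF closure_subset], rule complex_vector.span_base) blast

lemma module_image_mono: "proj_le E F \<Longrightarrow> module_image \<U> E \<subseteq> module_image \<U> F"
  unfolding module_image_def proj_le_def
  by (intro closure_mono complex_vector.span_mono) blast

text \<open>
  On the invariant subspace generated by \<open>x\<close> a right module reaches, up to closure, nothing that
  it does not reach from \<open>x\<close> itself, because \<open>\<U> (\<A> x) \<subseteq> \<U> x\<close>.
\<close>

lemma module_image_cyclic:
  assumes U: "right_submodule \<A> \<U>"
    and E: "range (blinfun_apply E) = closure ((\<lambda>A. blinfun_apply A x) ` \<A>)"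
  shows "module_image \<U> E \<subseteq> closure ((\<lambda>S. blinfun_apply S x) ` \<U>)"
proof -
  let ?W = "closure ((\<lambda>S. blinfun_apply S x) ` \<U>)"
  have sub: "complex_vector.subspace \<U>"
    and mult: "\<And>S A. S \<in> \<U> \<Longrightarrow> A \<in> \<A> \<Longrightarrow> S o\<^sub>L A \<in> \<U>"
    using U by (auto simp: right_submodule_def op_subspace_def)
  have "blinfun_apply S ` closure ((\<lambda>A. blinfun_apply A x) ` \<A>) \<subseteq> ?W" if S: "S \<in> \<U>" for S
  proof (rule image_closure_subset)
    show "continuous_on (closure ((\<lambda>A. blinfun_apply A x) ` \<A>)) (blinfun_apply S)"
      by (intro continuous_intros)
    have "S (A x) \<in> (\<lambda>S. blinfun_apply S x) ` \<U>" if "A \<in> \<A>" for A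
      using mult[OF S that] by (auto intro!: image_eqI[of _ _ "S o\<^sub>L A"])
    then show "blinfun_apply S ` (\<lambda>A. blinfun_apply A x) ` \<A> \<subseteq> ?W"
      using closure_subset by blast
  qed simp
  then have "{blinfun_apply S v | S v. S \<in> \<U> \<and> v \<in> range (blinfun_apply E)} \<subseteq> ?W"
    unfolding E by blast
  moreover have "complex_vector.subspace ?W"
    by (intro complex_subspace_closure subspace_evaluations sub)
  ultimately have "complex_vector.span {blinfun_apply S v | S v. S \<in> \<U> \<and> v \<in> range (blinfun_apply E)} \<subseteq> ?W"
    by (rule complex_vector.span_minimal)
  then show ?thesis unfolding module_image_def by (rule closure_minimal) simp
qed

lemma right_submodule_memI:
  assumes A: "unital_op_algebra \<A>" "rank_one_generated \<A>"
    and U: "right_submodule \<A> \<U>" and cl: "closedin sigma_weak \<U>"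
    and T: "T \<in> bounded_ops"
    and maps: "\<And>E. E \<in> Lat \<A> \<Longrightarrow> blinfun_apply T ` range (blinfun_apply E) \<subseteq> module_image \<U> E"
  shows "T \<in> \<U>"
proof -
  have sub: "complex_vector.subspace \<U>" and ops: "\<U> \<subseteq> bounded_ops"
    and mult: "\<And>S A. S \<in> \<U> \<Longrightarrow> A \<in> \<A> \<Longrightarrow> S o\<^sub>L A \<in> \<U>"
    using U by (auto simp: right_submodule_def op_subspace_def)
  have "T o\<^sub>L R \<in> \<U>" if R: "R \<in> \<A>" "rank_one R" for R
  proof -
    obtain x where x: "x \<noteq> 0" "\<And>z. \<exists>c. R z = c *\<^sub>C x" using rank_one_range[OF R(2)] by blast
    let ?E = "projection_onto (closure ((\<lambda>A. blinfun_apply A x) ` \<A>))"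
    note E = range_cyclic_projection[OF A(1), of x]
    have "T x \<in> module_image \<U> ?E"
      using maps[OF cyclic_projection_in_Lat[OF A(1), of x]] in_cyclic_subspace[OF A(1), of x]
      unfolding E by blast
    then have "T x \<in> closure ((\<lambda>S. blinfun_apply S x) ` \<U>)"
      using module_image_cyclic[OF U E] by blast
    then have "T o\<^sub>L R \<in> closure ((\<lambda>S. S o\<^sub>L R) ` \<U>)"
      by (rule compose_rank_one_in_closure[OF x(2,1) ops T])
    moreover have "(\<lambda>S. S o\<^sub>L R) ` \<U> \<subseteq> \<U>" using mult R by blast
    ultimately have "T o\<^sub>L R \<in> closure \<U>" using closure_mono by blast
    moreover have "T o\<^sub>L R \<in> bounded_ops"
      using T R(2) by (intro compose_in_bounded_ops) (auto simp: rank_one_def)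
    ultimately show ?thesis using norm_closure_in_sigma_weak_closed[OF cl] by blast
  qed
  then have "T o\<^sub>L id_blinfun \<in> \<U>"
    using T by (intro image_of_identity_in_closed_subspace[OF A sub cl
        continuous_map_sigma_weak_compose_left[OF T]])
      (auto intro!: blinfun_eqI simp: blinfun.add_left blinfun.add_right bounded_ops_def scaleC_blinfun.rep_eq)
  moreover have "T o\<^sub>L id_blinfun = T" by (rule blinfun_eqI) simp
  ultimately show ?thesis by simp
qed

section \<open>Left modules\<close>

definition module_preimage :: "('a::complex_hilbert \<Rightarrow>\<^sub>L 'a) set \<Rightarrow> ('a \<Rightarrow>\<^sub>L 'a) \<Rightarrow> 'a set"
  where "module_preimage \<U> E = {x. \<forall>S\<in>\<U>. blinfun_apply S x \<in> range (blinfun_apply E)}"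

lemma
  assumes U: "\<U> \<subseteq> bounded_ops" and E: "E \<in> projections"
  shows subspace_module_preimage: "complex_vector.subspace (module_preimage \<U> E)"
    and closed_module_preimage: "closed (module_preimage \<U> E)"
proof -
  note R = subspace_range_projection[OF E]
  show "complex_vector.subspace (module_preimage \<U> E)"
  proof (rule complex_vector.subspaceI)
    fix c x assume "x \<in> module_preimage \<U> E"
    moreover have "S (c *\<^sub>C x) = c *\<^sub>C S x" if "S \<in> \<U>" for S
      using U that by (auto simp: bounded_ops_def)
    ultimately show "c *\<^sub>C x \<in> module_preimage \<U> E"
      using complex_vector.subspace_scale[OF R] by (simp add: module_preimage_def)
  qed (simp_all add: module_preimage_def blinfun.add_right complex_vector.subspace_add[OF R]
      complex_vector.subspace_0[OF R])
  have "module_preimage \<U> E = (\<Inter>S\<in>\<U>. blinfun_apply S -` range (blinfun_apply E))"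
    by (auto simp: module_preimage_def)
  then show "closed (module_preimage \<U> E)"
    by (auto intro!: closed_INT continuous_closed_vimage closed_range_projection[OF E] continuous_intros)
qed

lemma module_preimage_mono: "proj_le E F \<Longrightarrow> module_preimage \<U> E \<subseteq> module_preimage \<U> F"
  unfolding module_preimage_def proj_le_def by blast

text \<open>
  The orthogonal complement of \<open>\<A>\<^sup>* y\<close> is the largest invariant subspace orthogonal to \<open>y\<close>.
\<close>

lemma
  fixes y :: "'a::complex_hilbert"
  assumes A: "unital_op_algebra \<A>"
  defines "V \<equiv> {v. \<forall>A\<in>\<A>. cinner (blinfun_apply A v) y = 0}"
  shows annihilator_projection_in_Lat: "projection_onto V \<in> Lat \<A>"
    and range_annihilator_projection: "range (blinfun_apply (projection_onto V)) = V"
proof -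
  have ops: "\<A> \<subseteq> bounded_ops" and mult: "\<And>S T. S \<in> \<A> \<Longrightarrow> T \<in> \<A> \<Longrightarrow> S o\<^sub>L T \<in> \<A>"
    using A by (auto simp: unital_op_algebra_def op_subspace_def)
  interpret ci: bounded_linear "\<lambda>x. cinner x y" by (rule bounded_linear_cinner_left)
  have "complex_vector.subspace V"
    using ops by (auto simp: V_def complex_vector.subspace_def blinfun.add_right ci.add ci.zero
        bounded_ops_def cinner_scaleC_left subset_iff)
  moreover have "V = (\<Inter>A\<in>\<A>. {v. cinner (blinfun_apply A v) y = 0})" by (auto simp: V_def)
  then have "closed V"
    by (auto intro!: closed_INT closed_Collect_eq ci.continuous_on continuous_intros)
  ultimately have V: "projection_onto V \<in> projections" "range (blinfun_apply (projection_onto V)) = V"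
    using projection_onto range_projection_onto by blast+
  show "range (blinfun_apply (projection_onto V)) = V" by (rule V)
  have "B v \<in> V" if B: "B \<in> \<A>" and v: "v \<in> V" for B v
    using v mult[OF _ B] by (force simp: V_def)
  then show "projection_onto V \<in> Lat \<A>"
    using V(1) by (auto simp: Lat_def maps_into_def V(2))
qed

text \<open>
  A vector \<open>z\<close> satisfies the premise of \<open>ker\<close> iff it is orthogonal to \<open>\<U>\<^sup>* y\<close>, so \<open>ker\<close> says that
  \<open>T\<^sup>* y\<close> is orthogonal to every such \<open>z\<close>. Its own component orthogonal to \<open>\<U>\<^sup>* y\<close> is one of them
  and therefore vanishes, which puts \<open>T\<^sup>* y\<close> into the closure of \<open>\<U>\<^sup>* y\<close>.
\<close>

lemma functional_approximation:
  assumes sub: "complex_vector.subspace \<U>" and ops: "\<U> \<subseteq> bounded_ops" and T: "T \<in> bounded_ops"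
    and ker: "\<And>z. (\<And>S. S \<in> \<U> \<Longrightarrow> cinner (blinfun_apply S z) y = 0) \<Longrightarrow> cinner (blinfun_apply T z) y = 0"
    and e: "e > 0"
  shows "\<exists>S\<in>\<U>. \<forall>z. norm (cinner (blinfun_apply (S - T) z) y) \<le> e * norm z"
proof -
  have "\<forall>S\<in>bounded_ops. \<exists>w. \<forall>x. cinner (blinfun_apply S x) y = cinner x w"
    using adjoint_exists by blast
  then obtain w where w: "\<And>S x. S \<in> bounded_ops \<Longrightarrow> cinner (blinfun_apply S x) y = cinner x (w S)"
    by metis
  \<comment> \<open>\<open>w S\<close> plays the role of \<open>S\<^sup>* y\<close>; it is determined by its defining identity.\<close>
  have w_eq: "w S = v" if "S \<in> bounded_ops" "\<And>x. cinner (blinfun_apply S x) y = cinner x v" for S v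
  proof -
    have "cinner (w S - v) (w S - v) = 0"
      using w[OF that(1)] that(2) by (simp add: cinner_diff_right)
    then show ?thesis using cinner_self_eq_0 by fastforce
  qed
  have "complex_vector.subspace (w ` \<U>)"
  proof (rule complex_vector.subspaceI)
    have "w 0 = 0"
      by (rule w_eq) (use ops complex_vector.subspace_0[OF sub] in auto)
    then show "0 \<in> w ` \<U>" using complex_vector.subspace_0[OF sub] by force
  next
    fix u v assume "u \<in> w ` \<U>" "v \<in> w ` \<U>"
    then obtain S S' where S: "S \<in> \<U>" "S' \<in> \<U>" "u = w S" "v = w S'" by blast
    have in_U: "S + S' \<in> \<U>" using S complex_vector.subspace_add[OF sub] by blast
    then have "w (S + S') = u + v"
      using ops S by (intro w_eq) (auto simp: blinfun.add_left cinner_add_left cinner_add_right w subset_iff)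
    then show "u + v \<in> w ` \<U>" using in_U by force
  next
    \<comment> \<open>\<open>S \<mapsto> w S\<close> is conjugate linear.\<close>
    fix c u assume "u \<in> w ` \<U>"
    then obtain S where S: "S \<in> \<U>" "u = w S" by blast
    have in_U: "cnj c *\<^sub>C S \<in> \<U>" using S complex_vector.subspace_scale[OF sub] by blast
    then have "w (cnj c *\<^sub>C S) = c *\<^sub>C u"
      using ops S by (intro w_eq)
        (auto simp: scaleC_blinfun.rep_eq cinner_scaleC_left cinner_scaleC_right w subset_iff)
    then show "c *\<^sub>C u \<in> w ` \<U>" using in_U by force
  qed
  then obtain p where p: "p \<in> closure (w ` \<U>)"
    and orth: "\<And>v. v \<in> closure (w ` \<U>) \<Longrightarrow> cinner (w T - p) v = 0"
    using complex_orthogonal_decomposition[OF complex_subspace_closure closed_closure] by blast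
  have "cinner (blinfun_apply S (w T - p)) y = 0" if "S \<in> \<U>" for S
    using orth[of "w S"] w[OF subsetD[OF ops that]] that closure_subset[of "w ` \<U>"] by auto
  then have "cinner (w T - p) (w T) = 0" using ker w[OF T] by metis
  then have "cinner (w T - p) (w T - p) = 0" using orth[OF p] by (simp only: cinner_diff_right) simp
  then have "w T \<in> closure (w ` \<U>)" using p cinner_self_eq_0 by fastforce
  then obtain S where S: "S \<in> \<U>" "dist (w S) (w T) < e"
    using e unfolding closure_approachable by blast
  have "norm (cinner ((S - T) z) y) \<le> e * norm z" for z
  proof -
    have "cinner ((S - T) z) y = cinner z (w S - w T)"
      using w[of S] w[OF T] S ops by (auto simp: blinfun.diff_left cinner_diff_left cinner_diff_right)
    then have "norm (cinner ((S - T) z) y) \<le> norm z * dist (w S) (w T)"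
      using norm_cinner_le by (simp add: dist_norm)
    also have "\<dots> \<le> norm z * e" using S by (intro mult_left_mono) auto
    finally show ?thesis by (simp add: mult.commute)
  qed
  then show ?thesis using S by blast
qed

text \<open>
  Dually to \<open>compose_rank_one_in_closure\<close>, the operator \<open>R o\<^sub>L S\<close> depends only on the functional
  \<open>\<langle>S z, y\<rangle>\<close> of \<open>z\<close>.
\<close>

lemma rank_one_compose_in_closure:
  fixes R T :: "'a::complex_hilbert \<Rightarrow>\<^sub>L 'a"
  assumes R: "\<And>z. blinfun_apply R z = (cinner z y / k) *\<^sub>C x" and sub: "complex_vector.subspace \<U>"
    and ops: "\<U> \<subseteq> bounded_ops" and T: "T \<in> bounded_ops"
    and ker: "\<And>z. (\<And>S. S \<in> \<U> \<Longrightarrow> cinner (blinfun_apply S z) y = 0) \<Longrightarrow> cinner (blinfun_apply T z) y = 0"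
  shows "R o\<^sub>L T \<in> closure ((\<lambda>S. R o\<^sub>L S) ` \<U>)"
  unfolding closure_approachable
proof (intro allI impI)
  fix e :: real assume e: "e > 0"
  define K where "K = norm x / cmod k"
  \<comment> \<open>\<open>K\<close> may vanish, hence the summand \<open>1\<close>.\<close>
  define d where "d = e / (K + 1)"
  have K: "K \<ge> 0" by (simp add: K_def)
  then have "d > 0" using e by (simp add: d_def)
  then obtain S where S: "S \<in> \<U>" and bd: "\<And>z. norm (cinner ((S - T) z) y) \<le> d * norm z"
    using functional_approximation[OF sub ops T ker] by blast
  have "norm ((R o\<^sub>L S) - (R o\<^sub>L T)) \<le> d * K"
  proof (rule norm_blinfun_bound)
    show "0 \<le> d * K" using K \<open>d > 0\<close> by simp
    fix z
    have "((R o\<^sub>L S) - (R o\<^sub>L T)) z = R ((S - T) z)"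
      by (simp add: blinfun.diff_left blinfun.diff_right)
    then have "norm (((R o\<^sub>L S) - (R o\<^sub>L T)) z) = norm (cinner ((S - T) z) y) * K"
      by (simp add: R norm_scaleC norm_divide K_def)
    also have "\<dots> \<le> d * norm z * K" using bd K by (rule mult_right_mono)
    finally show "norm (((R o\<^sub>L S) - (R o\<^sub>L T)) z) \<le> d * K * norm z" by (simp add: mult_ac)
  qed
  also have "\<dots> < e" using e K by (simp add: d_def divide_simps)
  finally show "\<exists>Y\<in>(\<lambda>S. R o\<^sub>L S) ` \<U>. dist Y (R o\<^sub>L T) < e"
    using S by (auto simp: dist_norm)
qed

lemma rank_one_cinner:
  assumes "rank_one R"
  shows "\<exists>x y k. \<forall>z. R z = (cinner z y / k) *\<^sub>C x"
proof -
  obtain x where x: "x \<noteq> 0" "\<And>z. \<exists>c. R z = c *\<^sub>C x" using rank_one_range[OF assms] by blast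
  obtain R' where R': "\<And>x y. cinner (R x) y = cinner x (R' y)"
    using adjoint_exists assms unfolding rank_one_def by blast
  have "R z = (cinner z (R' x) / cinner x x) *\<^sub>C x" for z
  proof -
    obtain c where c: "R z = c *\<^sub>C x" using x by blast
    then have "cinner z (R' x) = c * cinner x x" by (simp add: cinner_scaleC_left flip: R')
    moreover have "cinner x x \<noteq> 0" using x cinner_self_eq_0 by blast
    ultimately show ?thesis by (simp add: c)
  qed
  then show ?thesis by blast
qed

lemma left_submodule_memI:
  assumes A: "unital_op_algebra \<A>" "rank_one_generated \<A>"
    and U: "left_submodule \<A> \<U>" and cl: "closedin sigma_weak \<U>"
    and T: "T \<in> bounded_ops"
    and maps: "\<And>E. E \<in> Lat \<A> \<Longrightarrow> blinfun_apply T ` module_preimage \<U> E \<subseteq> range (blinfun_apply E)"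
  shows "T \<in> \<U>"
proof -
  have sub: "complex_vector.subspace \<U>" and ops: "\<U> \<subseteq> bounded_ops"
    and mult: "\<And>S A. S \<in> \<U> \<Longrightarrow> A \<in> \<A> \<Longrightarrow> A o\<^sub>L S \<in> \<U>"
    using U by (auto simp: left_submodule_def op_subspace_def)
  have one: "id_blinfun \<in> \<A>" using A by (simp add: unital_op_algebra_def)
  have "R o\<^sub>L T \<in> \<U>" if R: "R \<in> \<A>" "rank_one R" for R
  proof -
    obtain x y k where xy: "\<And>z. R z = (cinner z y / k) *\<^sub>C x"
      using rank_one_cinner[OF R(2)] by blast
    \<comment> \<open>This is the complement of \<open>\<A>\<^sup>* y\<close>, so its \<open>module_preimage\<close> is the complement of \<open>\<U>\<^sup>* y\<close>.\<close>
    let ?V = "{v. \<forall>A\<in>\<A>. cinner (blinfun_apply A v) y = 0}"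
    note E = range_annihilator_projection[OF A(1), of y]
    have ker: "cinner (T z) y = 0" if z: "\<And>S. S \<in> \<U> \<Longrightarrow> cinner (blinfun_apply S z) y = 0" for z
    proof -
      have "z \<in> module_preimage \<U> (projection_onto ?V)"
        using z[OF mult] by (auto simp: module_preimage_def E)
      then have "T z \<in> ?V"
        using maps[OF annihilator_projection_in_Lat[OF A(1), of y]] unfolding E by blast
      then have "cinner (id_blinfun (T z)) y = 0" using one by blast
      then show ?thesis by simp
    qed
    have "R o\<^sub>L T \<in> closure ((\<lambda>S. R o\<^sub>L S) ` \<U>)"
      by (rule rank_one_compose_in_closure[OF xy sub ops T ker])
    moreover have "(\<lambda>S. R o\<^sub>L S) ` \<U> \<subseteq> \<U>" using mult R by blast
    ultimately have "R o\<^sub>L T \<in> closure \<U>" using closure_mono by blast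
    moreover have "R o\<^sub>L T \<in> bounded_ops"
      using T R(2) by (intro compose_in_bounded_ops) (auto simp: rank_one_def)
    ultimately show ?thesis using norm_closure_in_sigma_weak_closed[OF cl] by blast
  qed
  then have "id_blinfun o\<^sub>L T \<in> \<U>"
    by (intro image_of_identity_in_closed_subspace[OF A sub cl
        continuous_map_sigma_weak_compose_right[OF T]])
      (auto intro!: blinfun_eqI simp: blinfun.add_left scaleC_blinfun.rep_eq)
  moreover have "id_blinfun o\<^sub>L T = T" by (rule blinfun_eqI) simp
  ultimately show ?thesis by simp
qed

section \<open>Both module classes are determined by order homomorphisms\<close>

theorem corollary2p2:
  fixes \<A> :: "('a::complex_hilbert \<Rightarrow>\<^sub>L 'a) set"
  assumes "unital_op_algebra \<A>"
    and "closedin sigma_weak \<A>"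
    and "rank_one_generated \<A>"
  shows "(\<forall>\<U>. right_submodule \<A> \<U> \<and> closedin sigma_weak \<U> \<longrightarrow>
            (\<exists>\<phi>\<in>order_hom (Lat \<A>) projections.
              \<U> = {T \<in> bounded_ops. \<forall>E\<in>Lat \<A>. maps_into T E (\<phi> E)}))
       \<and> (\<forall>\<U>. left_submodule \<A> \<U> \<and> closedin sigma_weak \<U> \<longrightarrow>
            (\<exists>\<psi>\<in>order_hom (Lat \<A>) projections.
              \<U> = {T \<in> bounded_ops. \<forall>E\<in>Lat \<A>. maps_into T (\<psi> E) E}))"
proof (intro conjI allI impI; elim conjE)
  fix \<U> assume U: "right_submodule \<A> \<U>" and cl: "closedin sigma_weak \<U>"
  define \<phi> where "\<phi> E = projection_onto (module_image \<U> E)" for E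
  have proj: "\<phi> E \<in> projections" and range: "range (blinfun_apply (\<phi> E)) = module_image \<U> E" for E
    unfolding \<phi>_def
    by (rule projection_onto range_projection_onto subspace_module_image closed_module_image)+
  have "\<phi> \<in> order_hom (Lat \<A>) projections"
    by (auto simp: order_hom_def monotone_on_def proj proj_le_def[of "\<phi> _"] range
        dest: module_image_mono)
  moreover have "\<U> = {T \<in> bounded_ops. \<forall>E\<in>Lat \<A>. maps_into T E (\<phi> E)}" (is "_ = ?M")
  proof
    show "\<U> \<subseteq> ?M"
      using U apply_in_module_image
      by (fastforce simp: maps_into_def range right_submodule_def op_subspace_def)
    show "?M \<subseteq> \<U>"
      using right_submodule_memI[OF assms(1,3) U cl] by (auto simp: maps_into_def range)
  qed
  ultimately show "\<exists>\<phi>\<in>order_hom (Lat \<A>) projections.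
      \<U> = {T \<in> bounded_ops. \<forall>E\<in>Lat \<A>. maps_into T E (\<phi> E)}" by blast
next
  fix \<U> assume U: "left_submodule \<A> \<U>" and cl: "closedin sigma_weak \<U>"
  have ops: "\<U> \<subseteq> bounded_ops" using U by (simp add: left_submodule_def op_subspace_def)
  define \<psi> where "\<psi> E = projection_onto (module_preimage \<U> E)" for E
  have proj: "\<psi> E \<in> projections" and range: "range (blinfun_apply (\<psi> E)) = module_preimage \<U> E"
    if "E \<in> Lat \<A>" for E
    using that subspace_module_preimage[OF ops] closed_module_preimage[OF ops]
    by (simp_all add: \<psi>_def projection_onto range_projection_onto Lat_def)
  have "\<psi> \<in> order_hom (Lat \<A>) projections"
    by (auto simp: order_hom_def monotone_on_def proj proj_le_def[of "\<psi> _"] range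
        dest: module_preimage_mono)
  moreover have "\<U> = {T \<in> bounded_ops. \<forall>E\<in>Lat \<A>. maps_into T (\<psi> E) E}" (is "_ = ?M")
  proof
    show "\<U> \<subseteq> ?M"
      using ops by (auto simp: maps_into_def range module_preimage_def)
    show "?M \<subseteq> \<U>"
      using left_submodule_memI[OF assms(1,3) U cl] by (auto simp: maps_into_def range)
  qed
  ultimately show "\<exists>\<psi>\<in>order_hom (Lat \<A>) projections.
      \<U> = {T \<in> bounded_ops. \<forall>E\<in>Lat \<A>. maps_into T (\<psi> E) E}" by blast
qed

end
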